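(* Let $\mathcal G=(G\rightrightarrows M)$ and $\mathcal G'=(G'\rightrightarrows M)$ be Lie groupoids with source maps $\alpha,\alpha'$, and let $\psi\colon G\to G'$ be an isomorphism of Lie groupoids over $\mathrm{id}_M$. Let $H\subseteq G$ be a wide Lie subgroupoid of $\mathcal G$ and $K:=\psi(H)$. Then $F_H\big(S_{\mathcal G}(\alpha)\big)$ and $F_K\big(S_{\mathcal G'}(\alpha')\big)$ are isomorphic as topological groups (with the very strong topology, respectively the fine very strong topology, inherited from $C^\infty(G,G)$ and $C^\infty(G',G')$) via $$\Psi\colon F_H\big(S_{\mathcal G}(\alpha)\big)\to F_K\big(S_{\mathcal G'}(\alpha')\big),\qquad f\mapsto\psi\circ f\circ\psi^{-1}.$$
   Context: All manifolds are Hausdorff; $G,G',M$ are finite-dimensional and paracompact. In a Lie groupoid $G\rightrightarrows M$ the source $\alpha$ and target $\beta$ are submersions $G\to M$; the product $xy$ is defined iff $\alpha(x)=\beta(y)$, and then $\beta(xy)=\beta(x)$, $\alpha(xy)=\alpha(y)$; $M$ is identified with the submanifold of units of $G$. A subgroupoid is wide if it contains all units. $S_{\mathcal G}=\{f\in C^\infty(G,G)\mid\beta\circ f=\alpha\}$ is a monoid under $(f\star g)(x)=f(x)\,g\big(xf(x)\big)$ with unit $\alpha$; its group of units is $S_{\mathcal G}(\alpha)=\{f\in S_{\mathcal G}\mid R_f\in\mathrm{Diff}(G)\}$, where $R_f(x)=xf(x)$. For $H\subseteq G$ the setwise stabiliser is $F_H\big(S_{\mathcal G}(\alpha)\big)=\{f\in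 S_{\mathcal G}(\alpha): R_f(H)=H\}$, a subgroup of $(S_{\mathcal G}(\alpha),\star)$. Topologies on $C^\infty(X,Y)$: the very strong topology has as basis the sets $\bigcap_{i\in\Lambda}\mathcal N^{r_i}(f;A_i,(U_i,\phi_i),(V_i,\psi_i),\epsilon_i)$, where $(A_i)$ is a locally finite family of compact subsets of $X$, $(U_i,\phi_i)$, $(V_i,\psi_i)$ are charts of $X$, $Y$ with $A_i\subseteq U_i$, $f(A_i)\subseteq V_i$, $r_i\in\mathbb N_0$, $\epsilon_i>0$, and $\mathcal N^r(f;A,(U,\phi),(V,\psi),\epsilon)$ is the set of smooth $h$ with $h(A)\subseteq V$ such that all partial derivatives of order $\le r$ of $\psi\circ h\circ\phi^{-1}-\psi\circ f\circ\phi^{-1}$ have norm $<\epsilon$ on $\phi(A)$. Write $f\sim g$ if the closure of $\{f\neq g\}$ is compact; the fine very strong topology is generated by the very strong topology and the $\sim$-classes. *)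

theory Defs
  imports "HOL-Analysis.Analysis" "HOL-Algebra.Group"
begin

section \<open>Smooth functions on open subsets of Euclidean spaces\<close>

text \<open>
  The space of real \<open>n\<close>-tuples is the library's \<^const>\<open>Euclidean_space\<close> \<open>n\<close>: sequences of reals
  vanishing from index \<open>n\<close> on.  Unlike a model type of class \<open>euclidean_space\<close>, this covers
  dimension \<open>0\<close> (needed for Lie groups, i.e. Lie groupoids over a point) and allows the dimension
  to be a natural number, so that products and submanifolds of manifolds can be formed.
\<close>

definition pderiv_at :: "nat \<Rightarrow> ((nat \<Rightarrow> real) \<Rightarrow> real) \<Rightarrow> (nat \<Rightarrow> real) \<Rightarrow> real" where
  "pderiv_at j F x = deriv (\<lambda>t. F (x(j := t))) (x j)"

text \<open>\<open>iter_pderiv [j\<^sub>1, \<dots>, j\<^sub>k] F\<close> is the partial derivative of order \<open>k\<close> in the directions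
  \<open>j\<^sub>k, \<dots>, j\<^sub>1\<close>; the empty list gives \<open>F\<close> itself.\<close>

definition iter_pderiv :: "nat list \<Rightarrow> ((nat \<Rightarrow> real) \<Rightarrow> real) \<Rightarrow> (nat \<Rightarrow> real) \<Rightarrow> real" where
  "iter_pderiv js F = foldr pderiv_at js F"

definition smooth_real_on :: "nat \<Rightarrow> (nat \<Rightarrow> real) set \<Rightarrow> ((nat \<Rightarrow> real) \<Rightarrow> real) \<Rightarrow> bool" where
  "smooth_real_on n S F \<longleftrightarrow>
     (\<forall>js. set js \<subseteq> {..<n} \<longrightarrow>
        continuous_map (subtopology (Euclidean_space n) S) euclideanreal (iter_pderiv js F) \<and>
        (\<forall>x\<in>S. \<forall>j<n. (\<lambda>t. iter_pderiv js F (x(j := t))) differentiable (at (x j))))"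

definition smooth_on ::
    "nat \<Rightarrow> nat \<Rightarrow> (nat \<Rightarrow> real) set \<Rightarrow> ((nat \<Rightarrow> real) \<Rightarrow> nat \<Rightarrow> real) \<Rightarrow> bool" where
  "smooth_on n m S F \<longleftrightarrow> (\<forall>i<m. smooth_real_on n S (\<lambda>x. F x i))"


section \<open>Manifolds\<close>

text \<open>Values of \<open>cmap\<close> outside \<open>cdom\<close> are irrelevant.\<close>

record 'a chart =
  cdom :: "'a set"
  cdim :: nat
  cmap :: "'a \<Rightarrow> nat \<Rightarrow> real"

definition chart_image :: "'a chart \<Rightarrow> 'a set \<Rightarrow> (nat \<Rightarrow> real) set" where
  "chart_image c A = cmap c ` (cdom c \<inter> A)"

definition topological_chart :: "'a topology \<Rightarrow> 'a chart \<Rightarrow> bool" where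
  "topological_chart T c \<longleftrightarrow>
     openin T (cdom c) \<and>
     openin (Euclidean_space (cdim c)) (cmap c ` cdom c) \<and>
     homeomorphic_map (subtopology T (cdom c))
       (subtopology (Euclidean_space (cdim c)) (cmap c ` cdom c)) (cmap c)"

text \<open>The local representative \<open>\<psi> \<circ> f \<circ> \<phi>\<inverse>\<close>, meaningful on
  \<open>chart_image c (f -` cdom d)\<close> only.\<close>

definition local_rep ::
    "'a chart \<Rightarrow> 'b chart \<Rightarrow> ('a \<Rightarrow> 'b) \<Rightarrow> (nat \<Rightarrow> real) \<Rightarrow> nat \<Rightarrow> real" where
  "local_rep c d f = cmap d \<circ> f \<circ> inv_into (cdom c) (cmap c)"

definition smoothly_compatible :: "'a chart \<Rightarrow> 'a chart \<Rightarrow> bool" where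
  "smoothly_compatible c d \<longleftrightarrow>
     smooth_on (cdim c) (cdim d) (chart_image c (cdom d)) (local_rep c d id) \<and>
     smooth_on (cdim d) (cdim c) (chart_image d (cdom c)) (local_rep d c id)"

record 'a mfd =
  mtop :: "'a topology"
  charts :: "'a chart set"

abbreviation points :: "'a mfd \<Rightarrow> 'a set" where
  "points X \<equiv> topspace (mtop X)"

definition paracompact_space :: "'a topology \<Rightarrow> bool" where
  "paracompact_space T \<longleftrightarrow>
     (\<forall>\<U>. (\<forall>U\<in>\<U>. openin T U) \<and> \<Union>\<U> = topspace T \<longrightarrow>
        (\<exists>\<V>. (\<forall>V\<in>\<V>. openin T V \<and> (\<exists>U\<in>\<U>. V \<subseteq> U)) \<and> \<Union>\<V> = topspace T \<and>
              locally_finite_in T \<V>))"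

text \<open>A finite-dimensional Hausdorff paracompact smooth manifold without boundary;
  \<^const>\<open>charts\<close> is its maximal atlas.  The dimension may differ between components.\<close>

definition manifold :: "'a mfd \<Rightarrow> bool" where
  "manifold X \<longleftrightarrow>
     Hausdorff_space (mtop X) \<and> paracompact_space (mtop X) \<and>
     (\<forall>c\<in>charts X. topological_chart (mtop X) c) \<and>
     (\<forall>c\<in>charts X. \<forall>d\<in>charts X. smoothly_compatible c d) \<and>
     (\<Union>c\<in>charts X. cdom c) = points X \<and>
     (\<forall>c. topological_chart (mtop X) c \<and> (\<forall>d\<in>charts X. smoothly_compatible c d)
            \<longrightarrow> c \<in> charts X)"

definition generated_mfd :: "'a topology \<Rightarrow> 'a chart set \<Rightarrow> 'a mfd" where
  "generated_mfd T \<A> =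
     \<lparr>mtop = T, charts = {c. topological_chart T c \<and> (\<forall>d\<in>\<A>. smoothly_compatible c d)}\<rparr>"

definition smooth_map :: "'a mfd \<Rightarrow> 'b mfd \<Rightarrow> ('a \<Rightarrow> 'b) \<Rightarrow> bool" where
  "smooth_map X Y f \<longleftrightarrow>
     continuous_map (mtop X) (mtop Y) f \<and>
     (\<forall>c\<in>charts X. \<forall>d\<in>charts Y.
        smooth_on (cdim c) (cdim d) (chart_image c (f -` cdom d)) (local_rep c d f))"

text \<open>Elements of \<open>C\<^sup>\<infinity>(X,Y)\<close> are extensional, so that equality of HOL functions is equality of
  maps on \<open>X\<close>.\<close>

definition smooth_maps :: "'a mfd \<Rightarrow> 'b mfd \<Rightarrow> ('a \<Rightarrow> 'b) set" where
  "smooth_maps X Y = {f \<in> extensional (points X). smooth_map X Y f}"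

definition diffeomorphism :: "'a mfd \<Rightarrow> 'b mfd \<Rightarrow> ('a \<Rightarrow> 'b) \<Rightarrow> bool" where
  "diffeomorphism X Y f \<longleftrightarrow>
     bij_betw f (points X) (points Y) \<and> smooth_map X Y f \<and>
     smooth_map Y X (inv_into (points X) f)"

text \<open>The tangent map at \<open>x\<close> in the charts \<open>c\<close>, \<open>d\<close>: the Jacobian matrix applied to \<open>v\<close>.\<close>

definition local_tangent ::
    "'a chart \<Rightarrow> 'b chart \<Rightarrow> ('a \<Rightarrow> 'b) \<Rightarrow> 'a \<Rightarrow> (nat \<Rightarrow> real) \<Rightarrow> nat \<Rightarrow> real" where
  "local_tangent c d f x v =
     (\<lambda>i. if i < cdim d
          then \<Sum>j<cdim c. pderiv_at j (\<lambda>y. local_rep c d f y i) (cmap c x) * v j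
          else 0)"

definition submersion :: "'a mfd \<Rightarrow> 'b mfd \<Rightarrow> ('a \<Rightarrow> 'b) \<Rightarrow> bool" where
  "submersion X Y f \<longleftrightarrow> smooth_map X Y f \<and>
     (\<forall>c\<in>charts X. \<forall>d\<in>charts Y. \<forall>x \<in> cdom c \<inter> f -` cdom d.
        local_tangent c d f x ` topspace (Euclidean_space (cdim c))
          = topspace (Euclidean_space (cdim d)))"

definition immersion :: "'a mfd \<Rightarrow> 'b mfd \<Rightarrow> ('a \<Rightarrow> 'b) \<Rightarrow> bool" where
  "immersion X Y f \<longleftrightarrow> smooth_map X Y f \<and>
     (\<forall>c\<in>charts X. \<forall>d\<in>charts Y. \<forall>x \<in> cdom c \<inter> f -` cdom d.
        inj_on (local_tangent c d f x) (topspace (Euclidean_space (cdim c))))"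

definition prod_chart :: "'a chart \<Rightarrow> 'b chart \<Rightarrow> ('a \<times> 'b) chart" where
  "prod_chart c d =
     \<lparr>cdom = cdom c \<times> cdom d, cdim = cdim c + cdim d,
      cmap = (\<lambda>(x, y) i. if i < cdim c then cmap c x i else cmap d y (i - cdim c))\<rparr>"

definition prod_mfd :: "'a mfd \<Rightarrow> 'b mfd \<Rightarrow> ('a \<times> 'b) mfd" where
  "prod_mfd X Y = generated_mfd (prod_topology (mtop X) (mtop Y))
     {prod_chart c d |c d. c \<in> charts X \<and> d \<in> charts Y}"

text \<open>The structure induced on an embedded submanifold \<open>S\<close> of \<open>X\<close>: the atlas is generated by the
  restrictions to \<open>S\<close> of those charts of \<open>X\<close> that map \<open>S\<close> to the coordinate subspace of the first
  \<open>k\<close> coordinates.\<close>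

definition embedded_mfd :: "'a mfd \<Rightarrow> 'a set \<Rightarrow> 'a mfd" where
  "embedded_mfd X S = generated_mfd (subtopology (mtop X) S)
     {\<lparr>cdom = cdom c \<inter> S, cdim = k, cmap = cmap c\<rparr> |c k.
        c \<in> charts X \<and> k \<le> cdim c \<and>
        cmap c ` (cdom c \<inter> S) = cmap c ` cdom c \<inter> topspace (Euclidean_space k)}"


section \<open>Lie groupoids\<close>

text \<open>\<open>src\<close> is \<open>\<alpha>\<close>, \<open>tgt\<close> is \<open>\<beta>\<close>, and \<open>idt\<close> is the map identifying an object with its unit;
  \<open>gmul x y\<close> is relevant only if \<open>src x = tgt y\<close>.\<close>

record ('g, 'm) groupoid =
  arr :: "'g mfd"
  obj :: "'m mfd"
  src :: "'g \<Rightarrow> 'm"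
  tgt :: "'g \<Rightarrow> 'm"
  idt :: "'m \<Rightarrow> 'g"
  gmul :: "'g \<Rightarrow> 'g \<Rightarrow> 'g"
  ginv :: "'g \<Rightarrow> 'g"

abbreviation arrows :: "('g, 'm) groupoid \<Rightarrow> 'g set" where
  "arrows \<G> \<equiv> points (arr \<G>)"

abbreviation objects :: "('g, 'm) groupoid \<Rightarrow> 'm set" where
  "objects \<G> \<equiv> points (obj \<G>)"

definition composable :: "('g, 'm) groupoid \<Rightarrow> ('g \<times> 'g) set" where
  "composable \<G> = {(x, y). x \<in> arrows \<G> \<and> y \<in> arrows \<G> \<and> src \<G> x = tgt \<G> y}"

text \<open>Since source and target are submersions, \<^const>\<open>composable\<close> is an embedded submanifold of
  the product, and smoothness of the multiplication refers to its induced structure.\<close>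

locale lie_groupoid =
  fixes \<G> :: "('g, 'm) groupoid"
  assumes manifold_arr: "manifold (arr \<G>)"
    and manifold_obj: "manifold (obj \<G>)"
    and submersion_src: "submersion (arr \<G>) (obj \<G>) (src \<G>)"
    and submersion_tgt: "submersion (arr \<G>) (obj \<G>) (tgt \<G>)"
    and smooth_idt: "smooth_map (obj \<G>) (arr \<G>) (idt \<G>)"
    and smooth_ginv: "smooth_map (arr \<G>) (arr \<G>) (ginv \<G>)"
    and smooth_gmul: "smooth_map (embedded_mfd (prod_mfd (arr \<G>) (arr \<G>)) (composable \<G>))
                        (arr \<G>) (\<lambda>(x, y). gmul \<G> x y)"
    and tgt_gmul: "\<And>x y. (x, y) \<in> composable \<G> \<Longrightarrow> tgt \<G> (gmul \<G> x y) = tgt \<G> x"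
    and src_gmul: "\<And>x y. (x, y) \<in> composable \<G> \<Longrightarrow> src \<G> (gmul \<G> x y) = src \<G> y"
    and gmul_assoc: "\<And>x y z. \<lbrakk>(x, y) \<in> composable \<G>; (y, z) \<in> composable \<G>\<rbrakk>
                       \<Longrightarrow> gmul \<G> (gmul \<G> x y) z = gmul \<G> x (gmul \<G> y z)"
    and src_idt: "\<And>m. m \<in> objects \<G> \<Longrightarrow> src \<G> (idt \<G> m) = m"
    and tgt_idt: "\<And>m. m \<in> objects \<G> \<Longrightarrow> tgt \<G> (idt \<G> m) = m"
    and gmul_idt: "\<And>x. x \<in> arrows \<G> \<Longrightarrow> gmul \<G> x (idt \<G> (src \<G> x)) = x"
    and idt_gmul: "\<And>x. x \<in> arrows \<G> \<Longrightarrow> gmul \<G> (idt \<G> (tgt \<G> x)) x = x"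
    and src_ginv: "\<And>x. x \<in> arrows \<G> \<Longrightarrow> src \<G> (ginv \<G> x) = tgt \<G> x"
    and tgt_ginv: "\<And>x. x \<in> arrows \<G> \<Longrightarrow> tgt \<G> (ginv \<G> x) = src \<G> x"
    and gmul_ginv: "\<And>x. x \<in> arrows \<G> \<Longrightarrow> gmul \<G> x (ginv \<G> x) = idt \<G> (tgt \<G> x)"
    and ginv_gmul: "\<And>x. x \<in> arrows \<G> \<Longrightarrow> gmul \<G> (ginv \<G> x) x = idt \<G> (src \<G> x)"

definition lie_groupoid_hom ::
    "('g, 'm) groupoid \<Rightarrow> ('h, 'n) groupoid \<Rightarrow> ('g \<Rightarrow> 'h) \<Rightarrow> ('m \<Rightarrow> 'n) \<Rightarrow> bool" where
  "lie_groupoid_hom \<G> \<G>' \<psi> \<psi>\<^sub>0 \<longleftrightarrow>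
     smooth_map (arr \<G>) (arr \<G>') \<psi> \<and> smooth_map (obj \<G>) (obj \<G>') \<psi>\<^sub>0 \<and>
     (\<forall>x\<in>arrows \<G>. src \<G>' (\<psi> x) = \<psi>\<^sub>0 (src \<G> x) \<and> tgt \<G>' (\<psi> x) = \<psi>\<^sub>0 (tgt \<G> x)) \<and>
     (\<forall>(x, y)\<in>composable \<G>. \<psi> (gmul \<G> x y) = gmul \<G>' (\<psi> x) (\<psi> y))"

definition lie_groupoid_iso_over_id ::
    "('g, 'm) groupoid \<Rightarrow> ('h, 'm) groupoid \<Rightarrow> ('g \<Rightarrow> 'h) \<Rightarrow> bool" where
  "lie_groupoid_iso_over_id \<G> \<G>' \<psi> \<longleftrightarrow>
     bij_betw \<psi> (arrows \<G>) (arrows \<G>') \<and>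
     lie_groupoid_hom \<G> \<G>' \<psi> id \<and>
     lie_groupoid_hom \<G>' \<G> (inv_into (arrows \<G>) \<psi>) id"

text \<open>A wide Lie subgroupoid is an immersed one: \<open>H\<close> carries a manifold structure \<open>N\<close>, possibly
  with a finer topology than that of \<open>\<G>\<close>, for which the inclusion is an immersion and the
  operations of \<open>\<G>\<close> restrict to a Lie groupoid over all of \<^term>\<open>obj \<G>\<close>.  In particular \<open>H\<close>
  contains all units and is closed under multiplication and inversion.\<close>

definition wide_lie_subgroupoid :: "('g, 'm) groupoid \<Rightarrow> 'g set \<Rightarrow> bool" where
  "wide_lie_subgroupoid \<G> H \<longleftrightarrow>
     (\<exists>N. points N = H \<and> immersion N (arr \<G>) id \<and> lie_groupoid (\<G>\<lparr>arr := N\<rparr>))"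


section \<open>The monoid of smooth self-maps and its group of units\<close>

definition self_maps :: "('g, 'm) groupoid \<Rightarrow> ('g \<Rightarrow> 'g) set" where
  "self_maps \<G> =
     {f \<in> smooth_maps (arr \<G>) (arr \<G>). \<forall>x\<in>arrows \<G>. tgt \<G> (f x) = src \<G> x}"

definition right_mult :: "('g, 'm) groupoid \<Rightarrow> ('g \<Rightarrow> 'g) \<Rightarrow> 'g \<Rightarrow> 'g" where
  "right_mult \<G> f = (\<lambda>x\<in>arrows \<G>. gmul \<G> x (f x))"

definition star :: "('g, 'm) groupoid \<Rightarrow> ('g \<Rightarrow> 'g) \<Rightarrow> ('g \<Rightarrow> 'g) \<Rightarrow> 'g \<Rightarrow> 'g" where
  "star \<G> f g = (\<lambda>x\<in>arrows \<G>. gmul \<G> (f x) (g (gmul \<G> x (f x))))"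

text \<open>The unit \<open>\<alpha>\<close> of the monoid is \<open>idt \<circ> src\<close>, objects being identified with their units.\<close>

definition self_map_monoid :: "('g, 'm) groupoid \<Rightarrow> ('g \<Rightarrow> 'g) monoid" where
  "self_map_monoid \<G> =
     \<lparr>carrier = self_maps \<G>, mult = star \<G>, one = (\<lambda>x\<in>arrows \<G>. idt \<G> (src \<G> x))\<rparr>"

definition unit_self_maps :: "('g, 'm) groupoid \<Rightarrow> ('g \<Rightarrow> 'g) set" where
  "unit_self_maps \<G> =
     {f \<in> self_maps \<G>. diffeomorphism (arr \<G>) (arr \<G>) (right_mult \<G> f)}"

definition stabiliser :: "('g, 'm) groupoid \<Rightarrow> 'g set \<Rightarrow> ('g \<Rightarrow> 'g) set" where
  "stabiliser \<G> H = {f \<in> unit_self_maps \<G>. right_mult \<G> f ` H = H}"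

definition stabiliser_group :: "('g, 'm) groupoid \<Rightarrow> 'g set \<Rightarrow> ('g \<Rightarrow> 'g) monoid" where
  "stabiliser_group \<G> H = self_map_monoid \<G> \<lparr>carrier := stabiliser \<G> H\<rparr>"


section \<open>The very strong and the fine very strong topology\<close>

definition basic_nbhd :: "'a mfd \<Rightarrow> 'b mfd \<Rightarrow> nat \<Rightarrow> ('a \<Rightarrow> 'b) \<Rightarrow> 'a set \<Rightarrow> 'a chart \<Rightarrow> 'b chart
    \<Rightarrow> real \<Rightarrow> ('a \<Rightarrow> 'b) set" where
  "basic_nbhd X Y r f A c d \<epsilon> =
     {h \<in> smooth_maps X Y. h ` A \<subseteq> cdom d \<and>
        (\<forall>js. set js \<subseteq> {..<cdim c} \<and> length js \<le> r \<longrightarrow>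
           (\<forall>x\<in>cmap c ` A.
              L2_set (\<lambda>i. iter_pderiv js (\<lambda>y. local_rep c d h y i - local_rep c d f y i) x)
                {..<cdim d} < \<epsilon>))}"

text \<open>An indexed family of data \<open>(r\<^sub>i, A\<^sub>i, (U\<^sub>i,\<phi>\<^sub>i), (V\<^sub>i,\<psi>\<^sub>i), \<epsilon>\<^sub>i)\<close> is given as the set \<open>\<Lambda>\<close> of its
  members, indexed by itself.  This loses no generality, as repeated members do not change the
  intersection.  Local finiteness is stated for the family, not for the set of the \<open>A\<^sub>i\<close>: near each
  point only finitely many \<^emph>\<open>members\<close> are involved, so one \<open>A\<close> cannot come with infinitely many
  data unless it is empty.\<close>

definition nbhd_family :: "'a mfd \<Rightarrow> 'b mfd \<Rightarrow> ('a \<Rightarrow> 'b)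
    \<Rightarrow> (nat \<times> 'a set \<times> 'a chart \<times> 'b chart \<times> real) set \<Rightarrow> bool" where
  "nbhd_family X Y f \<Lambda> \<longleftrightarrow>
     (\<forall>(r, A, c, d, \<epsilon>)\<in>\<Lambda>. compactin (mtop X) A \<and> c \<in> charts X \<and> d \<in> charts Y \<and>
        A \<subseteq> cdom c \<and> f ` A \<subseteq> cdom d \<and> 0 < \<epsilon>) \<and>
     (\<forall>x\<in>points X. \<exists>W. openin (mtop X) W \<and> x \<in> W \<and>
        finite {(r, A, c, d, \<epsilon>) \<in> \<Lambda>. A \<inter> W \<noteq> {}})"

definition elementary_nbhd :: "'a mfd \<Rightarrow> 'b mfd \<Rightarrow> ('a \<Rightarrow> 'b)
    \<Rightarrow> (nat \<times> 'a set \<times> 'a chart \<times> 'b chart \<times> real) set \<Rightarrow> ('a \<Rightarrow> 'b) set" where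
  "elementary_nbhd X Y f \<Lambda> =
     {h \<in> smooth_maps X Y. \<forall>(r, A, c, d, \<epsilon>)\<in>\<Lambda>. h \<in> basic_nbhd X Y r f A c d \<epsilon>}"

definition very_strong_topology :: "'a mfd \<Rightarrow> 'b mfd \<Rightarrow> ('a \<Rightarrow> 'b) topology" where
  "very_strong_topology X Y = topology_generated_by
     {elementary_nbhd X Y f \<Lambda> |f \<Lambda>. f \<in> smooth_maps X Y \<and> nbhd_family X Y f \<Lambda>}"

definition compactly_equal :: "'a mfd \<Rightarrow> ('a \<Rightarrow> 'b) \<Rightarrow> ('a \<Rightarrow> 'b) \<Rightarrow> bool" where
  "compactly_equal X f g \<longleftrightarrow>
     compactin (mtop X) (mtop X closure_of {x \<in> points X. f x \<noteq> g x})"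

definition fine_very_strong_topology :: "'a mfd \<Rightarrow> 'b mfd \<Rightarrow> ('a \<Rightarrow> 'b) topology" where
  "fine_very_strong_topology X Y = topology_generated_by
     ({U. openin (very_strong_topology X Y) U} \<union>
      {{g \<in> smooth_maps X Y. compactly_equal X f g} |f. f \<in> smooth_maps X Y})"


section \<open>Transport along an isomorphism\<close>

definition conj_map ::
    "('g, 'm) groupoid \<Rightarrow> ('h, 'm) groupoid \<Rightarrow> ('g \<Rightarrow> 'h) \<Rightarrow> ('g \<Rightarrow> 'g) \<Rightarrow> 'h \<Rightarrow> 'h" where
  "conj_map \<G> \<G>' \<psi> f = restrict (\<psi> \<circ> f \<circ> inv_into (arrows \<G>) \<psi>) (arrows \<G>')"

end

theory Submission
  imports Defs
begin

text \<open>
  Everything is transport of structure along \<open>\<psi>\<close>.  A diffeomorphism \<open>\<phi>\<close> carries a chart \<open>c\<close> of the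
  maximal atlas to the chart \<open>c \<circ> \<phi>\<inverse>\<close>, whose compatibility with any \<open>d\<close> is the smoothness of the
  local representatives of \<open>\<phi>\<close> and \<open>\<phi>\<inverse>\<close>.  With respect to carried charts, the local representative of
  a conjugated map equals that of the original map on the open chart image, so no chain rule is
  needed: conjugation preserves smoothness and maps the subbasic sets of both topologies onto
  subbasic sets.  On the algebraic side \<open>\<psi> \<circ> R\<^sub>f \<circ> \<psi>\<inverse>\<close> is the right multiplication by the
  conjugate of \<open>f\<close>.
\<close>

subsection \<open>Locality of smoothness\<close>

text \<open>Since \<open>j < n\<close>, moving coordinate \<open>j\<close> leaves the coordinates
  from \<open>n\<close> on equal to 0. Membership in \<open>S\<close> thus reduces to membership in
  an open set of the product topology, pulled back along a continuous line.\<close>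

lemma open_coordinate_line:
  assumes S: "openin (Euclidean_space n) S" and x: "x \<in> S" and j: "j < n"
  shows "open {t. x(j := t) \<in> S}"
proof -
  obtain U where U: "openin (powertop_real UNIV) U" and SU: "S = U \<inter> {x. \<forall>i\<ge>n. x i = 0}"
    using S unfolding Euclidean_space_def openin_subtopology by auto
  have "{t. x(j := t) \<in> S} = (\<lambda>t. x(j := t)) -` U"
    using x j unfolding SU by auto
  moreover have "open U"
    using U by (simp add: euclidean_product_topology)
  moreover have "continuous_on UNIV (\<lambda>t. x(j := t))"
  proof (rule continuous_on_coordinatewise_then_product)
    show "continuous_on UNIV (\<lambda>t. (x(j := t)) i)" for i
      by (cases "i = j") auto
  qed
  ultimately show ?thesis
    by (simp add: open_vimage)
qed

lemma eventually_coordinate_line: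
  assumes "openin (Euclidean_space n) S" "x \<in> S" "j < n"
  shows "\<forall>\<^sub>F t in nhds (x j). x(j := t) \<in> S"
  unfolding eventually_nhds
  by (rule exI[of _ "{t. x(j := t) \<in> S}"]) (use open_coordinate_line[OF assms] assms(2) in simp)

text \<open>Agreement at one point does not survive differentiation. The induction therefore carries
  agreement on all of the open set \<open>S\<close>, which near each of its points contains a piece
  of every coordinate line of index below \<open>n\<close>.\<close>

lemma iter_pderiv_cong:
  assumes S: "openin (Euclidean_space n) S" and "set js \<subseteq> {..<n}"
    and eq: "\<And>x. x \<in> S \<Longrightarrow> F x = G x" and "x \<in> S"
  shows "iter_pderiv js F x = iter_pderiv js G x"
  using assms(2,4)
proof (induction js arbitrary: x)
  case Nil
  then show ?case by (simp add: iter_pderiv_def eq)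
next
  case (Cons j js)
  then have j: "j < n" by simp
  have "\<forall>\<^sub>F t in nhds (x j). iter_pderiv js F (x(j := t)) = iter_pderiv js G (x(j := t))"
    using eventually_coordinate_line[OF S Cons.prems(2) j]
    by eventually_elim (use Cons in auto)
  then show ?case
    unfolding iter_pderiv_def foldr_Cons o_apply pderiv_at_def
    by (intro deriv_cong_ev) (simp_all add: iter_pderiv_def)
qed

lemma smooth_real_on_cong:
  assumes S: "openin (Euclidean_space n) S" and eq: "\<And>x. x \<in> S \<Longrightarrow> F x = G x"
    and F: "smooth_real_on n S F"
  shows "smooth_real_on n S G"
  unfolding smooth_real_on_def
proof (intro allI impI conjI ballI)
  fix js assume js: "set js \<subseteq> {..<n}"
  have it: "iter_pderiv js F x = iter_pderiv js G x" if "x \<in> S" for x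
    using iter_pderiv_cong[OF S js eq that] .
  show "continuous_map (subtopology (Euclidean_space n) S) euclideanreal (iter_pderiv js G)"
    by (rule continuous_map_eq[of _ _ "iter_pderiv js F"]) (use F js it in \<open>auto simp: smooth_real_on_def\<close>)
  fix x j assume x: "x \<in> S" and j: "j < n"
  have "(\<lambda>t. iter_pderiv js F (x(j := t))) differentiable (at (x j))"
    using F js x j by (auto simp: smooth_real_on_def)
  then obtain D where "((\<lambda>t. iter_pderiv js F (x(j := t))) has_derivative D) (at (x j))"
    by (auto simp: differentiable_def)
  then have "((\<lambda>t. iter_pderiv js G (x(j := t))) has_derivative D) (at (x j))"
    by (rule has_derivative_transform_within_open[OF _ open_coordinate_line[OF S x j]])
      (use x it in auto)
  then show "(\<lambda>t. iter_pderiv js G (x(j := t))) differentiable (at (x j))"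
    by (auto simp: differentiable_def)
qed

text \<open>This takes the place of the chain rule: it suffices to identify a local representative,
  pointwise on its open domain, with one already known to be smooth.\<close>

lemma smooth_on_cong:
  assumes "openin (Euclidean_space n) S" "\<And>x. x \<in> S \<Longrightarrow> F x = G x" "smooth_on n m S F"
  shows "smooth_on n m S G"
  unfolding smooth_on_def
proof (intro allI impI)
  fix i assume "i < m"
  then have "smooth_real_on n S (\<lambda>x. F x i)"
    using assms(3) by (simp add: smooth_on_def)
  then show "smooth_real_on n S (\<lambda>x. G x i)"
    by (rule smooth_real_on_cong[OF assms(1), rotated]) (simp add: assms(2))
qed

section \<open>Charts, their open images and local representatives\<close>

lemma topological_chart_subset: "topological_chart T c \<Longrightarrow> cdom c \<subseteq> topspace T"
  unfolding topological_chart_def using openin_subset by blast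

lemma topological_chart_inj: "topological_chart T c \<Longrightarrow> inj_on (cmap c) (cdom c)"
  using topological_chart_subset[of T c] homeomorphic_imp_injective_map
  unfolding topological_chart_def by (fastforce simp: Int_absorb1)

text \<open>\<open>U\<close> is cut down to the carrier because it will be the preimage under a
  total function, which may contain points outside the space. A chart is an open map onto an open
  set, so openness in its image is openness in Euclidean space.\<close>

lemma openin_chart_image:
  assumes c: "topological_chart T c" and U: "openin T (topspace T \<inter> U)"
  shows "openin (Euclidean_space (cdim c)) (chart_image c U)"
proof -
  have "openin (subtopology T (cdom c)) (cdom c \<inter> U)"
  proof -
    have "cdom c \<inter> U = (topspace T \<inter> U) \<inter> cdom c"
      using topological_chart_subset[OF c] by auto
    then show ?thesis using U openin_subtopology by blast
  qed
  then have "openin (subtopology (Euclidean_space (cdim c)) (cmap c ` cdom c)) (cmap c ` (cdom c \<inter> U))"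
    using c homeomorphic_imp_open_map unfolding topological_chart_def open_map_def by blast
  then show ?thesis
    using c openin_trans_full unfolding topological_chart_def chart_image_def by blast
qed

text \<open>Supplies the openness that \<open>smooth_on_cong\<close> asks of the domains occurring
  in \<open>smooth_map\<close>.\<close>

lemma openin_chart_image_vimage:
  fixes X :: "'a mfd" and Y :: "'b mfd"
  assumes c: "topological_chart (mtop X) c" and "topological_chart (mtop Y) d"
    and "continuous_map (mtop X) (mtop Y) f"
  shows "openin (Euclidean_space (cdim c)) (chart_image c (f -` cdom d))"
proof (rule openin_chart_image[OF c])
  have "points X \<inter> f -` cdom d = {x \<in> points X. f x \<in> cdom d}" by auto
  then show "openin (mtop X) (points X \<inter> f -` cdom d)"
    using assms unfolding topological_chart_def by (simp add: openin_continuous_map_preimage)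
qed

text \<open>Arguments of the form \<open>cmap c x\<close> keep \<open>inv_into\<close> on the chart
  image, where injectivity of the chart determines its value.\<close>

lemma local_rep_cmap:
  assumes "topological_chart T c" "x \<in> cdom c"
  shows "local_rep c d f (cmap c x) = cmap d (f x)"
  using inv_into_f_f[OF topological_chart_inj[OF assms(1)] assms(2)] by (simp add: local_rep_def)

lemma manifold_topological_chart: "manifold X \<Longrightarrow> c \<in> charts X \<Longrightarrow> topological_chart (mtop X) c"
  unfolding manifold_def by blast

lemma manifold_maximal:
  "\<lbrakk>manifold X; topological_chart (mtop X) c; \<And>d. d \<in> charts X \<Longrightarrow> smoothly_compatible c d\<rbrakk>
    \<Longrightarrow> c \<in> charts X"
  unfolding manifold_def by blast

text \<open>Serves for inverses given by \<open>inv_into\<close>, whose values are known on the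
  carrier only.\<close>

lemma smooth_map_cong:
  assumes X: "manifold X" and Y: "manifold Y" and f: "smooth_map X Y f"
    and eq: "\<And>x. x \<in> points X \<Longrightarrow> f x = g x"
  shows "smooth_map X Y g"
  unfolding smooth_map_def
proof (intro conjI ballI)
  show g: "continuous_map (mtop X) (mtop Y) g"
    using f continuous_map_eq[of _ _ f g] eq unfolding smooth_map_def by blast
  fix c d assume cd: "c \<in> charts X" "d \<in> charts Y"
  then have c: "topological_chart (mtop X) c" and d: "topological_chart (mtop Y) d"
    using X Y manifold_topological_chart by blast+
  have sub: "cdom c \<subseteq> points X" using topological_chart_subset[OF c] .
  have im: "chart_image c (g -` cdom d) = chart_image c (f -` cdom d)"
  proof -
    have "cdom c \<inter> g -` cdom d = cdom c \<inter> f -` cdom d" using sub eq by auto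
    then show ?thesis by (simp add: chart_image_def)
  qed
  show "smooth_on (cdim c) (cdim d) (chart_image c (g -` cdom d)) (local_rep c d g)"
  proof (rule smooth_on_cong[OF openin_chart_image_vimage[OF c d g]])
    show "smooth_on (cdim c) (cdim d) (chart_image c (g -` cdom d)) (local_rep c d f)"
      unfolding im using f cd unfolding smooth_map_def by blast
  qed (use sub eq local_rep_cmap[OF c, of _ d f] local_rep_cmap[OF c, of _ d g] in \<open>auto simp: chart_image_def\<close>)
qed

subsection \<open>Carrying charts along a diffeomorphism\<close>

text \<open>The inverse is a separate argument, so that exchanging \<open>\<phi>\<close> and
  \<open>\<phi>'\<close> gives the operation that carries charts back.\<close>

definition push_chart :: "('a \<Rightarrow> 'b) \<Rightarrow> ('b \<Rightarrow> 'a) \<Rightarrow> 'a chart \<Rightarrow> 'b chart" where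
  "push_chart \<phi> \<phi>' c = \<lparr>cdom = \<phi> ` cdom c, cdim = cdim c, cmap = cmap c \<circ> \<phi>'\<rparr>"

lemma push_chart_simps [simp]:
  "cdom (push_chart \<phi> \<phi>' c) = \<phi> ` cdom c"
  "cdim (push_chart \<phi> \<phi>' c) = cdim c"
  "cmap (push_chart \<phi> \<phi>' c) = cmap c \<circ> \<phi>'"
  by (simp_all add: push_chart_def)

text \<open>A diffeomorphism together with a chosen inverse. Unlike \<open>diffeomorphism\<close>,
  this is visibly symmetric, so that \<open>sym\<close> yields every result in the other direction
  as well.\<close>

locale diffeo_pair =
  fixes X :: "'a mfd" and X' :: "'b mfd" and \<phi> :: "'a \<Rightarrow> 'b" and \<phi>' :: "'b \<Rightarrow> 'a"
  assumes mfd: "manifold X" and mfd': "manifold X'"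
    and smooth: "smooth_map X X' \<phi>" and smooth': "smooth_map X' X \<phi>'"
    and inv: "\<And>x. x \<in> points X \<Longrightarrow> \<phi>' (\<phi> x) = x"
    and inv': "\<And>y. y \<in> points X' \<Longrightarrow> \<phi> (\<phi>' y) = y"
begin

lemma sym: "diffeo_pair X' X \<phi>' \<phi>"
  using mfd mfd' smooth smooth' inv inv' by unfold_locales

lemma homeo_maps: "homeomorphic_maps (mtop X) (mtop X') \<phi> \<phi>'"
  using smooth smooth' inv inv' unfolding homeomorphic_maps_def smooth_map_def by auto

lemma homeo: "homeomorphic_map (mtop X) (mtop X') \<phi>"
  using homeo_maps homeomorphic_map_maps by blast

lemma maps: "x \<in> points X \<Longrightarrow> \<phi> x \<in> points X'"
  using smooth by (auto simp: smooth_map_def continuous_map_def)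

lemma maps': "y \<in> points X' \<Longrightarrow> \<phi>' y \<in> points X"
  using smooth' by (auto simp: smooth_map_def continuous_map_def)

lemma chart: "c \<in> charts X \<Longrightarrow> topological_chart (mtop X) c"
  using manifold_topological_chart[OF mfd] .

lemma chart_sub: "c \<in> charts X \<Longrightarrow> x \<in> cdom c \<Longrightarrow> x \<in> points X"
  using chart topological_chart_subset by blast

lemma topological_push_chart:
  assumes c: "topological_chart (mtop X) c"
  shows "topological_chart (mtop X') (push_chart \<phi> \<phi>' c)"
proof -
  have sub: "cdom c \<subseteq> points X" using topological_chart_subset[OF c] .
  have im: "(cmap c \<circ> \<phi>') ` \<phi> ` cdom c = cmap c ` cdom c"
    using sub by (auto simp: image_image image_def subset_iff inv)
  have "homeomorphic_map (subtopology (mtop X') (\<phi> ` cdom c)) (subtopology (mtop X) (cdom c)) \<phi>'"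
  proof (rule homeomorphic_map_subtopologies)
    show "homeomorphic_map (mtop X') (mtop X) \<phi>'"
      using diffeo_pair.homeo[OF sym] .
    show "\<phi>' ` (points X' \<inter> \<phi> ` cdom c) = points X \<inter> cdom c"
      using sub maps inv by (force simp: image_iff)
  qed
  then have "homeomorphic_map (subtopology (mtop X') (\<phi> ` cdom c))
      (subtopology (Euclidean_space (cdim c)) (cmap c ` cdom c)) (cmap c \<circ> \<phi>')"
    using c homeomorphic_map_compose unfolding topological_chart_def by blast
  moreover have "openin (mtop X') (\<phi> ` cdom c)"
    using c homeomorphic_map_openness[OF homeo sub] unfolding topological_chart_def by blast
  ultimately show ?thesis
    using c im unfolding topological_chart_def by simp
qed

text \<open>Maximality of the atlas reduces membership to compatibility with every chart of
  \<open>X'\<close>.\<close>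

lemma push_chart_in_charts:
  assumes cX: "c \<in> charts X"
  shows "push_chart \<phi> \<phi>' c \<in> charts X'"
proof -
  let ?c = "push_chart \<phi> \<phi>' c"
  have c: "topological_chart (mtop X) c" and sub: "cdom c \<subseteq> points X"
    using chart[OF cX] topological_chart_subset by auto
  have c': "topological_chart (mtop X') ?c"
    using topological_push_chart[OF c] .
  have "smoothly_compatible ?c d" if dX: "d \<in> charts X'" for d
  proof -
    have d: "topological_chart (mtop X') d" and subd: "cdom d \<subseteq> points X'"
      using diffeo_pair.chart[OF sym dX] topological_chart_subset by auto
    have im: "chart_image ?c (cdom d) = chart_image c (\<phi> -` cdom d)"
      using sub inv by (force simp: chart_image_def image_iff subset_iff)
    \<comment> \<open>Here the inverse of the carried chart enters through \<open>inv_into\<close>,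
      so the transition map is matched with the representative of \<open>\<phi>\<close> only on its
      open domain.\<close>
    have "smooth_on (cdim c) (cdim d) (chart_image c (\<phi> -` cdom d)) (local_rep ?c d id)"
    proof (rule smooth_on_cong)
      show "openin (Euclidean_space (cdim c)) (chart_image c (\<phi> -` cdom d))"
        using openin_chart_image_vimage[OF c d] smooth unfolding smooth_map_def by blast
      show "smooth_on (cdim c) (cdim d) (chart_image c (\<phi> -` cdom d)) (local_rep c d \<phi>)"
        using smooth cX dX unfolding smooth_map_def by blast
      fix y assume "y \<in> chart_image c (\<phi> -` cdom d)"
      then obtain x where x: "x \<in> cdom c" "y = cmap c x" by (auto simp: chart_image_def)
      then have "y = cmap ?c (\<phi> x)" using sub inv by auto
      then have "local_rep ?c d id y = cmap d (\<phi> x)"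
        using x local_rep_cmap[OF c', of "\<phi> x" d id] by simp
      then show "local_rep c d \<phi> y = local_rep ?c d id y"
        using x local_rep_cmap[OF c] by metis
    qed
    moreover have "chart_image d (\<phi> ` cdom c) = chart_image d (\<phi>' -` cdom c)"
    proof -
      have "cdom d \<inter> \<phi> ` cdom c = cdom d \<inter> \<phi>' -` cdom c"
        using sub subd inv inv' by (force simp: image_iff)
      then show ?thesis by (simp add: chart_image_def)
    qed
    \<comment> \<open>In this direction the representatives agree as functions, since both use the
      same inverse of \<open>d\<close>.\<close>
    moreover have "local_rep d ?c id = local_rep d c \<phi>'"
      by (simp add: local_rep_def o_assoc)
    ultimately show ?thesis
      using smooth' cX dX im unfolding smoothly_compatible_def smooth_map_def by simp
  qed
  then show ?thesis
    using manifold_maximal[OF mfd' c'] by blast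
qed

end

subsection \<open>Conjugation on spaces of smooth maps\<close>

lemma smooth_map_into: "smooth_map X Y f \<Longrightarrow> x \<in> points X \<Longrightarrow> f x \<in> points Y"
  using continuous_map_image_subset_topspace[of "mtop X" "mtop Y" f] unfolding smooth_map_def by blast

lemma smooth_mapsD:
  assumes "f \<in> smooth_maps X Y"
  shows "smooth_map X Y f" "f \<in> extensional (points X)"
  using assms by (simp_all add: smooth_maps_def)

text \<open>As \<open>t\<close> and \<open>t'\<close> are mutually inverse, the preimage of a
  generating set under \<open>t\<close> is its image under \<open>t'\<close>, which is again a
  generating set. Continuity need only be tested on such sets.\<close>

lemma continuous_map_topology_generated_by:
  assumes t: "\<And>U. U \<in> \<B> \<Longrightarrow> t ` U \<in> \<B>'" and t': "\<And>U. U \<in> \<B>' \<Longrightarrow> t' ` U \<in> \<B>"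
    and inv: "\<And>x. x \<in> \<Union>\<B> \<Longrightarrow> t' (t x) = x" and inv': "\<And>y. y \<in> \<Union>\<B>' \<Longrightarrow> t (t' y) = y"
  shows "continuous_map (topology_generated_by \<B>) (topology_generated_by \<B>') t"
proof (rule continuous_on_generated_topo)
  fix U assume U: "U \<in> \<B>'"
  have "t -` U \<inter> \<Union>\<B> = t' ` U"
  proof (intro equalityI subsetI)
    fix x assume "x \<in> t -` U \<inter> \<Union>\<B>"
    then have "t x \<in> U" "x = t' (t x)" using inv[of x] by simp_all
    then show "x \<in> t' ` U" by blast
  next
    fix x assume "x \<in> t' ` U"
    then obtain y where y: "y \<in> U" "x = t' y" by blast
    then have "t x = y" using inv'[of y] U by blast
    then show "x \<in> t -` U \<inter> \<Union>\<B>" using y t'[OF U] by blast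
  qed
  then show "openin (topology_generated_by \<B>) (t -` U \<inter> topspace (topology_generated_by \<B>))"
    using topology_generated_by_Basis[OF t'[OF U]] by (simp add: topology_generated_by_topspace)
next
  show "t ` topspace (topology_generated_by \<B>) \<subseteq> \<Union>\<B>'"
    unfolding topology_generated_by_topspace image_Union using t by blast
qed

lemma homeomorphic_maps_topology_generated_by:
  assumes "\<And>U. U \<in> \<B> \<Longrightarrow> t ` U \<in> \<B>'" and "\<And>U. U \<in> \<B>' \<Longrightarrow> t' ` U \<in> \<B>"
    and "\<And>x. x \<in> \<Union>\<B> \<Longrightarrow> t' (t x) = x" and "\<And>y. y \<in> \<Union>\<B>' \<Longrightarrow> t (t' y) = y"
  shows "homeomorphic_maps (topology_generated_by \<B>) (topology_generated_by \<B>') t t'"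
  unfolding homeomorphic_maps_def topology_generated_by_topspace
proof (intro conjI ballI)
  show "continuous_map (topology_generated_by \<B>) (topology_generated_by \<B>') t"
    by (rule continuous_map_topology_generated_by[where t' = t']) (fact assms)+
  show "continuous_map (topology_generated_by \<B>') (topology_generated_by \<B>) t'"
    by (rule continuous_map_topology_generated_by[where t' = t]) (fact assms)+
qed (fact assms)+

text \<open>The restriction makes the result extensional, as members of \<open>smooth_maps\<close>
  are; only so can transporting back return the original function. With \<open>\<psi>\<close> for
  \<open>\<eta>\<close> and its inverse for \<open>\<phi>'\<close> this becomes
  \<open>conj_map\<close>.\<close>

definition transport ::
    "'b mfd \<Rightarrow> ('b \<Rightarrow> 'a) \<Rightarrow> ('c \<Rightarrow> 'd) \<Rightarrow> ('a \<Rightarrow> 'c) \<Rightarrow> 'b \<Rightarrow> 'd" where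
  "transport X' \<phi>' \<eta> f = (\<lambda>y\<in>points X'. \<eta> (f (\<phi>' y)))"

lemma nbhd_familyD:
  assumes "nbhd_family X Y f \<Lambda>" "(r, A, c, d, \<epsilon>) \<in> \<Lambda>"
  shows "compactin (mtop X) A" "c \<in> charts X" "d \<in> charts Y" "A \<subseteq> cdom c" "f ` A \<subseteq> cdom d" "0 < \<epsilon>"
proof -
  have "case (r, A, c, d, \<epsilon>) of (r, A, c, d, \<epsilon>) \<Rightarrow>
      compactin (mtop X) A \<and> c \<in> charts X \<and> d \<in> charts Y \<and> A \<subseteq> cdom c \<and> f ` A \<subseteq> cdom d \<and> 0 < \<epsilon>"
    using assms unfolding nbhd_family_def by (elim conjE) (rule bspec)
  then show "compactin (mtop X) A" "c \<in> charts X" "d \<in> charts Y" "A \<subseteq> cdom c" "f ` A \<subseteq> cdom d" "0 < \<epsilon>"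
    by simp_all
qed

text \<open>Independent pairs for domain and codomain keep two roles apart: the first moves compact
  sets and source charts, the second moves target charts.\<close>

locale diffeo_pairs = dom: diffeo_pair X X' \<phi> \<phi>' + cod: diffeo_pair Y Y' \<eta> \<eta>'
  for X :: "'a mfd" and X' :: "'b mfd" and \<phi> \<phi>' and Y :: "'c mfd" and Y' :: "'d mfd" and \<eta> \<eta>'
begin

abbreviation tr :: "('a \<Rightarrow> 'c) \<Rightarrow> 'b \<Rightarrow> 'd" where "tr \<equiv> transport X' \<phi>' \<eta>"

abbreviation tr' :: "('b \<Rightarrow> 'd) \<Rightarrow> 'a \<Rightarrow> 'c" where "tr' \<equiv> transport X \<phi> \<eta>'"

lemma sym: "diffeo_pairs X' X \<phi>' \<phi> Y' Y \<eta>' \<eta>"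
  using dom.sym cod.sym by (rule diffeo_pairs.intro)

lemma tr_apply: "x \<in> points X \<Longrightarrow> tr f (\<phi> x) = \<eta> (f x)"
  by (simp add: transport_def dom.maps dom.inv)

lemma tr'_tr:
  assumes f: "f \<in> smooth_maps X Y"
  shows "tr' (tr f) = f"
proof
  fix x
  show "tr' (tr f) x = f x"
  proof (cases "x \<in> points X")
    case True
    moreover have "f x \<in> points Y"
      using smooth_mapsD(1)[OF f] True by (rule smooth_map_into)
    ultimately show ?thesis
      by (simp add: transport_def dom.maps dom.inv cod.inv)
  next
    \<comment> \<open>Off the carrier both sides are \<open>undefined\<close>, by extensionality of
      \<open>f\<close>.\<close>
    case False
    then show ?thesis
      using extensional_arb[OF smooth_mapsD(2)[OF f] False] by (simp add: transport_def)
  qed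
qed

text \<open>Smoothness of \<open>tr f\<close> is tested in arbitrary charts of \<open>X'\<close> and
  \<open>Y'\<close>. These are carried back to charts of \<open>X\<close> and \<open>Y\<close>,
  where smoothness of \<open>f\<close> applies, and the two local representatives agree on the open
  chart image.\<close>

lemma smooth_map_tr:
  assumes f: "smooth_map X Y f"
  shows "smooth_map X' Y' (tr f)"
  unfolding smooth_map_def
proof (intro conjI ballI)
  have "continuous_map (mtop X') (mtop Y') (\<eta> \<circ> (f \<circ> \<phi>'))"
    using f dom.smooth' cod.smooth unfolding smooth_map_def
    by (intro continuous_map_compose[of _ "mtop Y"] continuous_map_compose[of _ "mtop X"]) simp_all
  then show cont: "continuous_map (mtop X') (mtop Y') (tr f)"
    by (rule continuous_map_eq) (simp add: transport_def)
  fix c' d' assume c': "c' \<in> charts X'" and d': "d' \<in> charts Y'"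
  let ?c = "push_chart \<phi>' \<phi> c'" and ?d = "push_chart \<eta>' \<eta> d'"
  have c: "?c \<in> charts X" and d: "?d \<in> charts Y"
    using diffeo_pair.push_chart_in_charts[OF dom.sym c']
      diffeo_pair.push_chart_in_charts[OF cod.sym d'] .
  note tc' = manifold_topological_chart[OF dom.mfd' c'] and td' = manifold_topological_chart[OF cod.mfd' d']
  note tc = manifold_topological_chart[OF dom.mfd c]
  have sub: "cdom c' \<subseteq> points X'" and subd: "cdom d' \<subseteq> points Y'"
    using topological_chart_subset[OF tc'] topological_chart_subset[OF td'] .
  have f_into: "f (\<phi>' y) \<in> points Y" if "y \<in> cdom c'" for y
    using smooth_map_into[OF f] dom.maps' sub that by blast
  \<comment> \<open>Since \<open>f (\<phi>' y)\<close> is a point of \<open>Y\<close>, where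
    \<open>\<eta>\<close> and \<open>\<eta>'\<close> cancel, membership in a chart domain may be
    tested on either side.\<close>
  have "f (\<phi>' y) \<in> \<eta>' ` cdom d' \<longleftrightarrow> tr f y \<in> cdom d'" if "y \<in> cdom c'" for y
  proof -
    have "tr f y = \<eta> (f (\<phi>' y))" using that sub by (auto simp: transport_def)
    moreover have "f (\<phi>' y) = \<eta>' w \<longleftrightarrow> \<eta> (f (\<phi>' y)) = w" if "w \<in> cdom d'" for w
      using cod.inv[OF f_into[OF \<open>y \<in> cdom c'\<close>]] cod.inv'[of w] subd that by auto
    then have "f (\<phi>' y) \<in> \<eta>' ` cdom d' \<longleftrightarrow> \<eta> (f (\<phi>' y)) \<in> cdom d'"
      by auto
    ultimately show ?thesis by simp
  qed
  then have "\<phi>' ` cdom c' \<inter> f -` \<eta>' ` cdom d' = \<phi>' ` (cdom c' \<inter> tr f -` cdom d')"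
    by auto
  moreover have "cmap c' (\<phi> (\<phi>' y)) = cmap c' y" if "y \<in> cdom c'" for y
    using dom.inv' sub that by auto
  ultimately have im: "chart_image ?c (f -` cdom ?d) = chart_image c' (tr f -` cdom d')"
    by (simp add: chart_image_def image_image)
  show "smooth_on (cdim c') (cdim d') (chart_image c' (tr f -` cdom d')) (local_rep c' d' (tr f))"
  proof (rule smooth_on_cong[OF openin_chart_image_vimage[OF tc' td' cont]])
    have "smooth_on (cdim ?c) (cdim ?d) (chart_image ?c (f -` cdom ?d)) (local_rep ?c ?d f)"
      using f c d unfolding smooth_map_def by blast
    then show "smooth_on (cdim c') (cdim d') (chart_image c' (tr f -` cdom d')) (local_rep ?c ?d f)"
      unfolding im by simp
    fix z assume "z \<in> chart_image c' (tr f -` cdom d')"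
    then obtain y where y: "y \<in> cdom c'" "z = cmap c' y" by (auto simp: chart_image_def)
    have "local_rep ?c ?d f (cmap ?c (\<phi>' y)) = cmap ?d (f (\<phi>' y))"
      by (rule local_rep_cmap[OF tc]) (use y in simp)
    moreover have "cmap ?c (\<phi>' y) = z" using y sub dom.inv' by auto
    ultimately show "local_rep ?c ?d f z = local_rep c' d' (tr f) z"
      using y sub local_rep_cmap[OF tc' y(1), of d' "tr f"] by (auto simp: transport_def)
  qed
qed

lemma tr_smooth_maps: "f \<in> smooth_maps X Y \<Longrightarrow> tr f \<in> smooth_maps X' Y'"
  using smooth_map_tr by (simp add: smooth_maps_def transport_def)

text \<open>Surjectivity comes from \<open>tr'\<close>, so images are described exactly by a
  corresponding predicate. This handles both the elementary neighbourhoods and the classes of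
  \<open>compactly_equal\<close>.\<close>

lemma image_tr_Collect:
  assumes "\<And>h. h \<in> smooth_maps X Y \<Longrightarrow> P' (tr h) \<longleftrightarrow> P h"
  shows "tr ` {h \<in> smooth_maps X Y. P h} = {h \<in> smooth_maps X' Y'. P' h}"
proof
  show "tr ` {h \<in> smooth_maps X Y. P h} \<subseteq> {h \<in> smooth_maps X' Y'. P' h}"
    using assms tr_smooth_maps by auto
  show "{h \<in> smooth_maps X' Y'. P' h} \<subseteq> tr ` {h \<in> smooth_maps X Y. P h}"
  proof clarify
    fix h assume h: "h \<in> smooth_maps X' Y'" "P' h"
    have "tr (tr' h) = h" and "tr' h \<in> smooth_maps X Y"
      using diffeo_pairs.tr'_tr[OF sym h(1)] diffeo_pairs.tr_smooth_maps[OF sym h(1)] .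
    then show "h \<in> tr ` {h \<in> smooth_maps X Y. P h}"
      using assms[of "tr' h"] h by (auto intro!: image_eqI[of _ _ "tr' h"])
  qed
qed

text \<open>The \<open>\<eta>\<close> in \<open>tr f\<close> cancels against the
  \<open>\<eta>'\<close> in the carried target chart, and \<open>\<phi>'\<close> against
  \<open>\<phi>\<close> at the source. This works on the whole source chart, also at points that
  \<open>f\<close> sends outside \<open>cdom d\<close>.\<close>

lemma local_rep_tr:
  assumes f: "smooth_map X Y f" and c: "c \<in> charts X" and z: "z \<in> cmap c ` cdom c"
  shows "local_rep (push_chart \<phi> \<phi>' c) (push_chart \<eta> \<eta>' d) (tr f) z = local_rep c d f z"
proof -
  obtain x where x: "x \<in> cdom c" "z = cmap c x" using z by auto
  then have xX: "x \<in> points X" using dom.chart_sub[OF c] by blast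
  let ?c = "push_chart \<phi> \<phi>' c" and ?d = "push_chart \<eta> \<eta>' d"
  have "local_rep ?c ?d (tr f) (cmap ?c (\<phi> x)) = cmap ?d (tr f (\<phi> x))"
    by (rule local_rep_cmap[OF dom.topological_push_chart[OF dom.chart[OF c]]]) (use x in simp)
  then show ?thesis
    using local_rep_cmap[OF dom.chart[OF c] x(1), of d f] x(2) xX smooth_map_into[OF f xX]
    by (simp add: tr_apply dom.inv cod.inv)
qed

lemma basic_nbhd_tr_iff:
  assumes f: "f \<in> smooth_maps X Y" and h: "h \<in> smooth_maps X Y"
    and c: "c \<in> charts X" and d: "d \<in> charts Y" and A: "A \<subseteq> cdom c"
  shows "tr h \<in> basic_nbhd X' Y' r (tr f) (\<phi> ` A) (push_chart \<phi> \<phi>' c) (push_chart \<eta> \<eta>' d) \<epsilon>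
    \<longleftrightarrow> h \<in> basic_nbhd X Y r f A c d \<epsilon>"
proof -
  let ?c = "push_chart \<phi> \<phi>' c" and ?d = "push_chart \<eta> \<eta>' d"
  have AX: "x \<in> points X" if "x \<in> A" for x
    using A dom.chart_sub[OF c] that by blast
  have hY: "h x \<in> points Y" if "x \<in> A" for x
    using AX that smooth_map_into[OF smooth_mapsD(1)[OF h]] by blast
  have "\<eta> (h x) \<in> \<eta> ` cdom d \<longleftrightarrow> h x \<in> cdom d" if "x \<in> A" for x
    using hY[OF that] cod.inv cod.chart_sub[OF d] by (metis image_iff)
  then have dom_iff: "tr h ` \<phi> ` A \<subseteq> cdom ?d \<longleftrightarrow> h ` A \<subseteq> cdom d"
    using AX by (simp add: image_subset_iff tr_apply)
  have im: "cmap ?c ` \<phi> ` A = cmap c ` A"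
    unfolding image_image by (rule image_cong) (use AX dom.inv in auto)
  have "iter_pderiv js (\<lambda>y. local_rep ?c ?d (tr h) y i - local_rep ?c ?d (tr f) y i) z
      = iter_pderiv js (\<lambda>y. local_rep c d h y i - local_rep c d f y i) z"
    if "set js \<subseteq> {..<cdim c}" "z \<in> cmap c ` A" for js z i
  \<comment> \<open>Derivatives on the image of \<open>A\<close> are compared through agreement on
    the image of the whole chart domain, because \<open>A\<close> is not assumed open.\<close>
  proof (rule iter_pderiv_cong[of "cdim c" "cmap c ` cdom c"])
    show "openin (Euclidean_space (cdim c)) (cmap c ` cdom c)"
      using dom.chart[OF c] unfolding topological_chart_def by blast
    show "z \<in> cmap c ` cdom c" using that A by blast
  qed (use that local_rep_tr[OF smooth_mapsD(1)[OF f] c] local_rep_tr[OF smooth_mapsD(1)[OF h] c] in simp_all)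
  then have "(\<forall>js. set js \<subseteq> {..<cdim c} \<and> length js \<le> r \<longrightarrow> (\<forall>z\<in>cmap c ` A.
        L2_set (\<lambda>i. iter_pderiv js (\<lambda>y. local_rep ?c ?d (tr h) y i - local_rep ?c ?d (tr f) y i) z)
          {..<cdim d} < \<epsilon>)) \<longleftrightarrow>
      (\<forall>js. set js \<subseteq> {..<cdim c} \<and> length js \<le> r \<longrightarrow> (\<forall>z\<in>cmap c ` A.
        L2_set (\<lambda>i. iter_pderiv js (\<lambda>y. local_rep c d h y i - local_rep c d f y i) z)
          {..<cdim d} < \<epsilon>))"
    by (simp cong: conj_cong)
  then show ?thesis
    using dom_iff im h tr_smooth_maps[OF h] unfolding basic_nbhd_def push_chart_simps(2) by simp
qed

definition push_datum :: "nat \<times> 'a set \<times> 'a chart \<times> 'c chart \<times> real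
    \<Rightarrow> nat \<times> 'b set \<times> 'b chart \<times> 'd chart \<times> real" where
  "push_datum = (\<lambda>(r, A, c, d, \<epsilon>). (r, \<phi> ` A, push_chart \<phi> \<phi>' c, push_chart \<eta> \<eta>' d, \<epsilon>))"

lemma image_elementary_nbhd:
  assumes f: "f \<in> smooth_maps X Y" and \<Lambda>: "nbhd_family X Y f \<Lambda>"
  shows "tr ` elementary_nbhd X Y f \<Lambda> = elementary_nbhd X' Y' (tr f) (push_datum ` \<Lambda>)"
  unfolding elementary_nbhd_def
proof (rule image_tr_Collect)
  fix h assume h: "h \<in> smooth_maps X Y"
  have "tr h \<in> basic_nbhd X' Y' r (tr f) (\<phi> ` A) (push_chart \<phi> \<phi>' c) (push_chart \<eta> \<eta>' d) \<epsilon>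
    \<longleftrightarrow> h \<in> basic_nbhd X Y r f A c d \<epsilon>" if "(r, A, c, d, \<epsilon>) \<in> \<Lambda>" for r A c d \<epsilon>
    using nbhd_familyD[OF \<Lambda> that] by (intro basic_nbhd_tr_iff[OF f h])
  then show "(\<forall>(r, A, c, d, \<epsilon>)\<in>push_datum ` \<Lambda>. tr h \<in> basic_nbhd X' Y' r (tr f) A c d \<epsilon>)
      \<longleftrightarrow> (\<forall>(r, A, c, d, \<epsilon>)\<in>\<Lambda>. h \<in> basic_nbhd X Y r f A c d \<epsilon>)"
    by (auto simp: push_datum_def)
qed

text \<open>Compactness passes to continuous images. For local finiteness at \<open>y\<close>, the
  neighbourhood is the image under \<open>\<phi>\<close> of one that works at
  \<open>\<phi>' y\<close>.\<close>

lemma nbhd_family_push: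
  assumes f: "f \<in> smooth_maps X Y" and \<Lambda>: "nbhd_family X Y f \<Lambda>"
  shows "nbhd_family X' Y' (tr f) (push_datum ` \<Lambda>)"
proof -
  have members: "compactin (mtop X') (\<phi> ` A) \<and> push_chart \<phi> \<phi>' c \<in> charts X' \<and>
      push_chart \<eta> \<eta>' d \<in> charts Y' \<and> \<phi> ` A \<subseteq> cdom (push_chart \<phi> \<phi>' c) \<and>
      tr f ` \<phi> ` A \<subseteq> cdom (push_chart \<eta> \<eta>' d) \<and> 0 < \<epsilon>"
    if mem: "(r, A, c, d, \<epsilon>) \<in> \<Lambda>" for r A c d \<epsilon>
  proof -
    note * = nbhd_familyD[OF \<Lambda> mem]
    have "compactin (mtop X') (\<phi> ` A)"
      using image_compactin[OF *(1)] dom.smooth unfolding smooth_map_def by blast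
    moreover have "tr f (\<phi> x) = \<eta> (f x)" if "x \<in> A" for x
      using tr_apply dom.chart_sub[OF *(2)] *(4) that by blast
    ultimately show ?thesis
      using * dom.push_chart_in_charts cod.push_chart_in_charts by auto
  qed
  have locally_finite: "\<exists>W. openin (mtop X') W \<and> y \<in> W \<and>
      finite {(r, A, c, d, \<epsilon>) \<in> push_datum ` \<Lambda>. A \<inter> W \<noteq> {}}" if y: "y \<in> points X'" for y
  proof -
    obtain W where W: "openin (mtop X) W" "\<phi>' y \<in> W" "finite {(r, A, c, d, \<epsilon>) \<in> \<Lambda>. A \<inter> W \<noteq> {}}"
      using \<Lambda> dom.maps'[OF y] unfolding nbhd_family_def by blast
    have WX: "W \<subseteq> points X" using openin_subset[OF W(1)] .
    \<comment> \<open>By injectivity of \<open>\<phi>\<close> on \<open>X\<close>, images meet only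
      if the original sets do.\<close>
    have meets: "A \<inter> W \<noteq> {}" if mem: "(r, A, c, d, \<epsilon>) \<in> \<Lambda>" and ne: "\<phi> ` A \<inter> \<phi> ` W \<noteq> {}" for r A c d \<epsilon>
    proof -
      have "A \<subseteq> points X"
        using nbhd_familyD(1)[OF \<Lambda> mem] by (rule compactin_subset_topspace)
      moreover obtain a w where "a \<in> A" "w \<in> W" "\<phi> a = \<phi> w" using ne by blast
      ultimately show ?thesis using WX dom.inv by (metis disjoint_iff subsetD)
    qed
    \<comment> \<open>An inclusion in the image of a finite set suffices; \<open>push_datum\<close>
      may identify data.\<close>
    have "{(r, A, c, d, \<epsilon>) \<in> push_datum ` \<Lambda>. A \<inter> \<phi> ` W \<noteq> {}}
        \<subseteq> push_datum ` {(r, A, c, d, \<epsilon>) \<in> \<Lambda>. A \<inter> W \<noteq> {}}"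
    proof (intro subsetI)
      fix p assume "p \<in> {(r, A, c, d, \<epsilon>) \<in> push_datum ` \<Lambda>. A \<inter> \<phi> ` W \<noteq> {}}"
      then obtain q where q: "q \<in> \<Lambda>" "p = push_datum q" and "case p of (r, A, c, d, \<epsilon>) \<Rightarrow> A \<inter> \<phi> ` W \<noteq> {}"
        by blast
      moreover obtain r A c d \<epsilon> where "q = (r, A, c, d, \<epsilon>)" by (cases q)
      ultimately have "q \<in> {(r, A, c, d, \<epsilon>) \<in> \<Lambda>. A \<inter> W \<noteq> {}}"
        using meets[of r A c d \<epsilon>] by (simp add: push_datum_def)
      with q(2) show "p \<in> push_datum ` {(r, A, c, d, \<epsilon>) \<in> \<Lambda>. A \<inter> W \<noteq> {}}" by blast
    qed
    then have "finite {(r, A, c, d, \<epsilon>) \<in> push_datum ` \<Lambda>. A \<inter> \<phi> ` W \<noteq> {}}"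
      by (rule finite_surj[OF W(3)])
    moreover have "openin (mtop X') (\<phi> ` W)"
      using homeomorphic_map_openness[OF dom.homeo WX] W(1) by blast
    moreover have "y \<in> \<phi> ` W" using W(2) dom.inv'[OF y] by (metis imageI)
    ultimately show ?thesis by blast
  qed
  show ?thesis
    unfolding nbhd_family_def
  proof
    show "\<forall>(r, A, c, d, \<epsilon>)\<in>push_datum ` \<Lambda>. compactin (mtop X') A \<and> c \<in> charts X' \<and>
        d \<in> charts Y' \<and> A \<subseteq> cdom c \<and> tr f ` A \<subseteq> cdom d \<and> 0 < \<epsilon>"
      using members by (force simp: push_datum_def simp del: push_chart_simps)
  qed (use locally_finite in blast)
qed

section \<open>Generating sets of the very strong and the fine very strong topology\<close>

lemma image_subbasic_very_strong:
  assumes "U \<in> {elementary_nbhd X Y f \<Lambda> |f \<Lambda>. f \<in> smooth_maps X Y \<and> nbhd_family X Y f \<Lambda>}"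
  shows "tr ` U \<in> {elementary_nbhd X' Y' f \<Lambda> |f \<Lambda>. f \<in> smooth_maps X' Y' \<and> nbhd_family X' Y' f \<Lambda>}"
proof -
  obtain f \<Lambda> where f: "f \<in> smooth_maps X Y" "nbhd_family X Y f \<Lambda>" and U: "U = elementary_nbhd X Y f \<Lambda>"
    using assms by blast
  show ?thesis
    unfolding U image_elementary_nbhd[OF f]
    using tr_smooth_maps[OF f(1)] nbhd_family_push[OF f] by blast
qed

text \<open>The empty family is admissible around any smooth map and imposes no condition, so its
  elementary neighbourhood is everything.\<close>

lemma topspace_very_strong: "topspace (very_strong_topology X Y) = smooth_maps X Y"
proof -
  have "elementary_nbhd X Y f {} = smooth_maps X Y" "nbhd_family X Y f {}" for f
    using openin_topspace by (auto simp: elementary_nbhd_def nbhd_family_def case_prod_unfold)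
  then show ?thesis
    unfolding very_strong_topology_def topology_generated_by_topspace
    by (auto simp: elementary_nbhd_def)
qed

lemma homeomorphic_maps_very_strong:
  "homeomorphic_maps (very_strong_topology X Y) (very_strong_topology X' Y') tr tr'"
  unfolding very_strong_topology_def
proof (rule homeomorphic_maps_topology_generated_by)
  show "tr' (tr f) = f"
    if "f \<in> \<Union> {elementary_nbhd X Y f \<Lambda> |f \<Lambda>. f \<in> smooth_maps X Y \<and> nbhd_family X Y f \<Lambda>}" for f
    using that topspace_very_strong tr'_tr
    unfolding very_strong_topology_def topology_generated_by_topspace by blast
  show "tr (tr' f) = f"
    if "f \<in> \<Union> {elementary_nbhd X' Y' f \<Lambda> |f \<Lambda>. f \<in> smooth_maps X' Y' \<and> nbhd_family X' Y' f \<Lambda>}" for f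
    using that diffeo_pairs.topspace_very_strong[OF sym] diffeo_pairs.tr'_tr[OF sym]
    unfolding very_strong_topology_def topology_generated_by_topspace by blast
qed (fact image_subbasic_very_strong, fact diffeo_pairs.image_subbasic_very_strong[OF sym])

text \<open>By injectivity of \<open>\<eta>\<close>, the set where the transported maps differ is
  the image under \<open>\<phi>\<close> of the set where the original ones do. A homeomorphism
  preserves closures and compactness.\<close>

lemma compactly_equal_tr_iff:
  assumes f: "f \<in> smooth_maps X Y" and g: "g \<in> smooth_maps X Y"
  shows "compactly_equal X' (tr f) (tr g) \<longleftrightarrow> compactly_equal X f g"
proof -
  have "\<eta> (f x) \<noteq> \<eta> (g x) \<longleftrightarrow> f x \<noteq> g x" if "x \<in> points X" for x
    using cod.inv smooth_map_into[OF smooth_mapsD(1)] f g that by metis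
  then have "{y \<in> points X'. tr f y \<noteq> tr g y} = \<phi> ` {x \<in> points X. f x \<noteq> g x}"
    using dom.maps dom.maps' dom.inv dom.inv' by (force simp: transport_def image_iff)
  then show ?thesis
    unfolding compactly_equal_def
    by (simp add: homeomorphic_map_closure_of[OF dom.homeo] homeomorphic_map_compactness[OF dom.homeo]
        closure_of_subset_topspace)
qed

lemma topspace_fine_very_strong: "topspace (fine_very_strong_topology X Y) = smooth_maps X Y"
  unfolding fine_very_strong_topology_def topology_generated_by_topspace
  using openin_subset[of "very_strong_topology X Y"] openin_topspace[of "very_strong_topology X Y"]
  unfolding topspace_very_strong by blast

text \<open>The generators include all very strongly open sets, not just the elementary ones, so the
  homeomorphism of the very strong topologies has to come first.\<close>

lemma image_subbasic_fine_very_strong: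
  assumes "U \<in> {U. openin (very_strong_topology X Y) U} \<union>
      {{g \<in> smooth_maps X Y. compactly_equal X f g} |f. f \<in> smooth_maps X Y}"
  shows "tr ` U \<in> {U. openin (very_strong_topology X' Y') U} \<union>
      {{g \<in> smooth_maps X' Y'. compactly_equal X' f g} |f. f \<in> smooth_maps X' Y'}"
proof -
  have "homeomorphic_map (very_strong_topology X Y) (very_strong_topology X' Y') tr"
    using homeomorphic_maps_very_strong homeomorphic_map_maps by blast
  then have "open_map (very_strong_topology X Y) (very_strong_topology X' Y') tr"
    by (rule homeomorphic_imp_open_map)
  then have "openin (very_strong_topology X' Y') (tr ` U)" if "openin (very_strong_topology X Y) U"
    using that by (simp add: open_map_def)
  moreover have "tr ` {g \<in> smooth_maps X Y. compactly_equal X f g}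
      = {g \<in> smooth_maps X' Y'. compactly_equal X' (tr f) g}" if "f \<in> smooth_maps X Y" for f
    by (rule image_tr_Collect) (rule compactly_equal_tr_iff[OF that])
  ultimately show ?thesis
    using assms tr_smooth_maps by (elim UnE CollectE exE conjE) blast+
qed

lemma homeomorphic_maps_fine_very_strong:
  "homeomorphic_maps (fine_very_strong_topology X Y) (fine_very_strong_topology X' Y') tr tr'"
  unfolding fine_very_strong_topology_def
proof (rule homeomorphic_maps_topology_generated_by)
  show "tr' (tr f) = f" if "f \<in> \<Union> ({U. openin (very_strong_topology X Y) U} \<union>
      {{g \<in> smooth_maps X Y. compactly_equal X f g} |f. f \<in> smooth_maps X Y})" for f
    using that topspace_fine_very_strong tr'_tr
    unfolding fine_very_strong_topology_def topology_generated_by_topspace by blast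
  show "tr (tr' f) = f" if "f \<in> \<Union> ({U. openin (very_strong_topology X' Y') U} \<union>
      {{g \<in> smooth_maps X' Y'. compactly_equal X' f g} |f. f \<in> smooth_maps X' Y'})" for f
    using that diffeo_pairs.topspace_fine_very_strong[OF sym] diffeo_pairs.tr'_tr[OF sym]
    unfolding fine_very_strong_topology_def topology_generated_by_topspace by blast
qed (fact image_subbasic_fine_very_strong, fact diffeo_pairs.image_subbasic_fine_very_strong[OF sym])

end


subsection \<open>Lie groupoids isomorphic over the identity\<close>

text \<open>The prefixes \<open>src\<close> and \<open>tgt\<close> refer to the two groupoids joined
  by \<open>\<psi>\<close>, not to source and target maps. Compatibility with the operations is
  stated for \<open>\<psi>\<close>; \<open>groupoid_sym\<close> derives it for
  \<open>\<psi>'\<close>.\<close>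

locale lie_groupoid_iso_pair =
  diffeo_pair "arr \<G>" "arr \<G>'" \<psi> \<psi>' + src: lie_groupoid \<G> + tgt: lie_groupoid \<G>'
  for \<G> :: "('g, 'm) groupoid" and \<G>' :: "('h, 'm) groupoid" and \<psi> \<psi>' +
  assumes src_hom: "\<And>x. x \<in> arrows \<G> \<Longrightarrow> src \<G>' (\<psi> x) = src \<G> x"
    and tgt_hom: "\<And>x. x \<in> arrows \<G> \<Longrightarrow> tgt \<G>' (\<psi> x) = tgt \<G> x"
    and gmul_hom: "\<And>x y. (x, y) \<in> composable \<G> \<Longrightarrow> \<psi> (gmul \<G> x y) = gmul \<G>' (\<psi> x) (\<psi> y)"

text \<open>Closure under products is contained in \<open>smooth_gmul\<close>, as a smooth map sends
  points to points.\<close>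

lemma (in lie_groupoid) gmul_in_arrows:
  assumes "(x, y) \<in> composable \<G>"
  shows "gmul \<G> x y \<in> arrows \<G>"
proof -
  let ?M = "embedded_mfd (prod_mfd (arr \<G>) (arr \<G>)) (composable \<G>)"
  have "(x, y) \<in> points ?M"
    using assms by (auto simp: embedded_mfd_def prod_mfd_def generated_mfd_def composable_def)
  from smooth_map_into[OF smooth_gmul this] show ?thesis by simp
qed

context lie_groupoid_iso_pair
begin

text \<open>The inverse of a bijective homomorphism is one too: apply the laws at preimages and
  cancel. Cancelling on a product uses that it is an arrow.\<close>

lemma groupoid_sym: "lie_groupoid_iso_pair \<G>' \<G> \<psi>' \<psi>"
proof (intro lie_groupoid_iso_pair.intro lie_groupoid_iso_pair_axioms.intro)
  show "diffeo_pair (arr \<G>') (arr \<G>) \<psi>' \<psi>" by (rule sym)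
  show "lie_groupoid \<G>'" "lie_groupoid \<G>" by unfold_locales
  show src: "src \<G> (\<psi>' y) = src \<G>' y" and tgt: "tgt \<G> (\<psi>' y) = tgt \<G>' y"
    if "y \<in> arrows \<G>'" for y
    using src_hom[of "\<psi>' y"] tgt_hom[of "\<psi>' y"] maps'[OF that] inv'[OF that] by simp_all
  fix x y assume xy: "(x, y) \<in> composable \<G>'"
  then have "(\<psi>' x, \<psi>' y) \<in> composable \<G>"
    using src tgt maps' by (auto simp: composable_def)
  moreover have "\<psi> (\<psi>' x) = x" "\<psi> (\<psi>' y) = y"
    using xy inv' by (auto simp: composable_def)
  ultimately show "\<psi>' (gmul \<G>' x y) = gmul \<G> (\<psi>' x) (\<psi>' y)"
    using gmul_hom inv src.gmul_in_arrows by metis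
qed

text \<open>Using the same pair on both sides turns \<open>maps.tr\<close> into conjugation by
  \<open>\<psi>\<close>.\<close>

sublocale maps: diffeo_pairs "arr \<G>" "arr \<G>'" \<psi> \<psi>' "arr \<G>" "arr \<G>'" \<psi> \<psi>'
  by unfold_locales

section \<open>Self-maps, right multiplications and the star product\<close>

lemma self_mapsD:
  assumes "f \<in> self_maps \<G>" "x \<in> arrows \<G>"
  shows "(x, f x) \<in> composable \<G>"
  using assms smooth_map_into[OF smooth_mapsD(1)] by (auto simp: self_maps_def composable_def)

lemma tr_self_maps:
  assumes "f \<in> self_maps \<G>"
  shows "maps.tr f \<in> self_maps \<G>'"
proof -
  have "tgt \<G>' (maps.tr f y) = src \<G>' y" if y: "y \<in> arrows \<G>'" for y
  proof -
    have "(\<psi>' y, f (\<psi>' y)) \<in> composable \<G>" using self_mapsD[OF assms maps'[OF y]] .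
    then show ?thesis
      using y tgt_hom[of "f (\<psi>' y)"] src_hom[of "\<psi>' y"] inv'[OF y]
      by (simp add: transport_def composable_def)
  qed
  then show ?thesis
    using assms maps.tr_smooth_maps unfolding self_maps_def by blast
qed

lemma right_mult_tr:
  assumes "f \<in> self_maps \<G>"
  shows "right_mult \<G>' (maps.tr f) = maps.tr (right_mult \<G> f)"
proof
  fix y
  show "right_mult \<G>' (maps.tr f) y = maps.tr (right_mult \<G> f) y"
    using gmul_hom[OF self_mapsD[OF assms maps'[of y]]] maps'[of y] inv'[of y]
    by (simp add: right_mult_def transport_def)
qed

lemma star_tr:
  assumes f: "f \<in> self_maps \<G>" and g: "g \<in> self_maps \<G>"
  shows "maps.tr (star \<G> f g) = star \<G>' (maps.tr f) (maps.tr g)"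
proof
  fix y
  show "maps.tr (star \<G> f g) y = star \<G>' (maps.tr f) (maps.tr g) y"
  proof (cases "y \<in> arrows \<G>'")
    case y: True
    define x where "x = \<psi>' y"
    have x: "x \<in> arrows \<G>" "y = \<psi> x" using y maps' inv' by (auto simp: x_def)
    have xf: "(x, f x) \<in> composable \<G>" using self_mapsD[OF f x(1)] .
    \<comment> \<open>This is R_f(x), where \<open>star\<close> evaluates \<open>g\<close>. Its
      source is that of \<open>f x\<close>, which makes \<open>f x\<close> and \<open>g z\<close>
      composable; \<open>\<psi>\<close> takes it to the point where the conjugate of
      \<open>g\<close> is evaluated.\<close>
    define z where "z = gmul \<G> x (f x)"
    have z: "z \<in> arrows \<G>" "src \<G> z = src \<G> (f x)"
      using src.gmul_in_arrows[OF xf] src.src_gmul[OF xf] by (simp_all add: z_def)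
    have "(f x, g z) \<in> composable \<G>"
      using self_mapsD[OF g z(1)] xf z(2) by (simp add: composable_def)
    moreover have "\<psi> z = gmul \<G>' (\<psi> x) (\<psi> (f x))"
      using gmul_hom[OF xf] by (simp add: z_def)
    ultimately have "\<psi> (gmul \<G> (f x) (g z)) = gmul \<G>' (maps.tr f y) (maps.tr g (gmul \<G>' y (maps.tr f y)))"
      using x z gmul_hom maps.tr_apply by metis
    then show ?thesis
      using y x by (simp add: star_def maps.tr_apply z_def)
  qed (simp add: star_def transport_def)
qed

text \<open>The conjugate of the inverse of \<open>F\<close> inverts the conjugate of
  \<open>F\<close>. As \<open>diffeomorphism\<close> speaks of \<open>inv_into\<close>, the two are
  identified on the arrows before smoothness is carried over.\<close>

lemma diffeomorphism_tr:
  assumes F: "diffeomorphism (arr \<G>) (arr \<G>) F"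
  shows "diffeomorphism (arr \<G>') (arr \<G>') (maps.tr F)"
proof -
  let ?F' = "inv_into (arrows \<G>) F"
  have bij: "bij_betw F (arrows \<G>) (arrows \<G>)" and smooth: "smooth_map (arr \<G>) (arr \<G>) F"
    "smooth_map (arr \<G>) (arr \<G>) ?F'"
    using F by (simp_all add: diffeomorphism_def)
  have tr: "maps.tr F y = \<psi> (F (\<psi>' y))" "maps.tr F y \<in> arrows \<G>'"
    and tr': "maps.tr ?F' y = \<psi> (?F' (\<psi>' y))" "maps.tr ?F' y \<in> arrows \<G>'"
    if "y \<in> arrows \<G>'" for y
    using that smooth_map_into[OF smooth(1)] smooth_map_into[OF smooth(2)] maps maps'
    by (simp_all add: transport_def)
  have left: "maps.tr ?F' (maps.tr F y) = y" and right: "maps.tr F (maps.tr ?F' y) = y"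
    if "y \<in> arrows \<G>'" for y
    using that tr tr' smooth_map_into[OF smooth(1)] smooth_map_into[OF smooth(2)] maps' inv inv'
      bij_betw_inv_into_left[OF bij] bij_betw_inv_into_right[OF bij] by simp_all
  have bij': "bij_betw (maps.tr F) (arrows \<G>') (arrows \<G>')"
    by (rule bij_betw_byWitness[where f' = "maps.tr ?F'"]) (use left right tr tr' in auto)
  have "smooth_map (arr \<G>') (arr \<G>') (inv_into (arrows \<G>') (maps.tr F))"
  proof (rule smooth_map_cong[OF mfd' mfd' maps.smooth_map_tr[OF smooth(2)]])
    fix y assume y: "y \<in> arrows \<G>'"
    have "inv_into (arrows \<G>') (maps.tr F) (maps.tr F (maps.tr ?F' y)) = maps.tr ?F' y"
      by (rule bij_betw_inv_into_left[OF bij' tr'(2)[OF y]])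
    then show "maps.tr ?F' y = inv_into (arrows \<G>') (maps.tr F) y"
      by (simp add: right[OF y])
  qed
  then show ?thesis
    using bij' maps.smooth_map_tr[OF smooth(1)] by (simp add: diffeomorphism_def)
qed

section \<open>Stabilisers under conjugation\<close>

lemma tr_stabiliser:
  assumes f: "f \<in> stabiliser \<G> H" and H: "H \<subseteq> arrows \<G>"
  shows "maps.tr f \<in> stabiliser \<G>' (\<psi> ` H)"
proof -
  have fs: "f \<in> self_maps \<G>" and diffeo: "diffeomorphism (arr \<G>) (arr \<G>) (right_mult \<G> f)"
    and stab: "right_mult \<G> f ` H = H"
    using f by (auto simp: stabiliser_def unit_self_maps_def)
  \<comment> \<open>The conjugate of R_f moves \<psi>(H) to \<psi>(R_f(H)), which is \<psi>(H) again
    when \<open>f\<close> stabilises \<open>H\<close>.\<close>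
  have "maps.tr (right_mult \<G> f) ` \<psi> ` H = \<psi> ` right_mult \<G> f ` H"
    unfolding image_image by (rule image_cong) (use H maps.tr_apply in auto)
  then show ?thesis
    using tr_self_maps[OF fs] diffeomorphism_tr[OF diffeo] right_mult_tr[OF fs] stab
    by (simp add: stabiliser_def unit_self_maps_def)
qed

lemma stabiliser_smooth_maps: "stabiliser \<G> H \<subseteq> smooth_maps (arr \<G>) (arr \<G>)"
  by (auto simp: stabiliser_def unit_self_maps_def self_maps_def)

lemma bij_betw_stabiliser:
  assumes H: "H \<subseteq> arrows \<G>"
  shows "bij_betw maps.tr (stabiliser \<G> H) (stabiliser \<G>' (\<psi> ` H))"
proof (rule bij_betw_byWitness[where f' = maps.tr'])
  have "\<psi> ` H \<subseteq> arrows \<G>'" using H maps by blast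
  \<comment> \<open>The symmetric instance sends the stabiliser of \<psi>(H) to that of
    \<psi>'(\<psi>(H)), which has to be recognised as \<open>H\<close>.\<close>
  moreover have "\<psi>' ` \<psi> ` H = H" using H inv by force
  ultimately show "maps.tr' ` stabiliser \<G>' (\<psi> ` H) \<subseteq> stabiliser \<G> H"
    using lie_groupoid_iso_pair.tr_stabiliser[OF groupoid_sym, of _ "\<psi> ` H"] by auto
  show "\<forall>f\<in>stabiliser \<G> H. maps.tr' (maps.tr f) = f"
    using maps.tr'_tr stabiliser_smooth_maps by blast
  show "\<forall>f\<in>stabiliser \<G>' (\<psi> ` H). maps.tr (maps.tr' f) = f"
    using diffeo_pairs.tr'_tr[OF maps.sym]
      lie_groupoid_iso_pair.stabiliser_smooth_maps[OF groupoid_sym] by blast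
qed (use tr_stabiliser H in blast)

lemma tr_iso:
  assumes "H \<subseteq> arrows \<G>"
  shows "maps.tr \<in> iso (stabiliser_group \<G> H) (stabiliser_group \<G>' (\<psi> ` H))"
  using bij_betw_stabiliser[OF assms] tr_stabiliser[OF _ assms] star_tr
  by (auto simp: iso_def hom_def stabiliser_group_def self_map_monoid_def
      stabiliser_def unit_self_maps_def)

text \<open>Arbitrary topologies on the spaces of smooth maps are allowed, so that one argument
  serves the very strong and the fine very strong topology.\<close>

lemma homeomorphic_map_stabiliser:
  assumes H: "H \<subseteq> arrows \<G>" and hom: "homeomorphic_maps T T' maps.tr maps.tr'"
    and T: "topspace T = smooth_maps (arr \<G>) (arr \<G>)"
    and T': "topspace T' = smooth_maps (arr \<G>') (arr \<G>')"
  shows "homeomorphic_map (subtopology T (stabiliser \<G> H)) (subtopology T' (stabiliser \<G>' (\<psi> ` H))) maps.tr"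
proof (rule homeomorphic_map_subtopologies)
  show "homeomorphic_map T T' maps.tr" using hom homeomorphic_map_maps by blast
  have "maps.tr ` stabiliser \<G> H = stabiliser \<G>' (\<psi> ` H)"
    using bij_betw_stabiliser[OF H] by (rule bij_betw_imp_surj_on)
  then show "maps.tr ` (topspace T \<inter> stabiliser \<G> H) = topspace T' \<inter> stabiliser \<G>' (\<psi> ` H)"
    using stabiliser_smooth_maps lie_groupoid_iso_pair.stabiliser_smooth_maps[OF groupoid_sym]
    unfolding T T' by (simp add: Int_absorb1)
qed

end

section \<open>Instantiation at the given isomorphism and subgroupoid\<close>

lemma lie_groupoid_iso_pair_inv_into:
  assumes "lie_groupoid \<G>" "lie_groupoid \<G>'" and iso: "lie_groupoid_iso_over_id \<G> \<G>' \<psi>"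
  shows "lie_groupoid_iso_pair \<G> \<G>' \<psi> (inv_into (arrows \<G>) \<psi>)"
proof (intro lie_groupoid_iso_pair.intro lie_groupoid_iso_pair_axioms.intro diffeo_pair.intro)
  have bij: "bij_betw \<psi> (arrows \<G>) (arrows \<G>')"
    using iso by (simp add: lie_groupoid_iso_over_id_def)
  show "manifold (arr \<G>)" "manifold (arr \<G>')"
    using assms(1,2) lie_groupoid.manifold_arr by blast+
  show "inv_into (arrows \<G>) \<psi> (\<psi> x) = x" if "x \<in> arrows \<G>" for x
    using bij_betw_inv_into_left[OF bij that] .
  show "\<psi> (inv_into (arrows \<G>) \<psi> y) = y" if "y \<in> arrows \<G>'" for y
    using bij_betw_inv_into_right[OF bij that] .
qed (use assms in \<open>auto simp: lie_groupoid_iso_over_id_def lie_groupoid_hom_def\<close>)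

text \<open>\<open>H\<close> is the carrier of an immersed structure whose inclusion
  \<open>id\<close> is a smooth map into the arrows.\<close>

lemma wide_lie_subgroupoid_subset:
  assumes "wide_lie_subgroupoid \<G> H"
  shows "H \<subseteq> arrows \<G>"
proof -
  obtain N where "points N = H" "smooth_map N (arr \<G>) id"
    using assms unfolding wide_lie_subgroupoid_def immersion_def by blast
  then show ?thesis using smooth_map_into by fastforce
qed

theorem proposition4p4:
  fixes \<G> :: "('g, 'm) groupoid" and \<G>' :: "('h, 'm) groupoid"
    and \<psi> :: "'g \<Rightarrow> 'h" and H :: "'g set" and K :: "'h set"
  assumes "lie_groupoid \<G>" and "lie_groupoid \<G>'" and "obj \<G>' = obj \<G>"
    and "lie_groupoid_iso_over_id \<G> \<G>' \<psi>"
    and "wide_lie_subgroupoid \<G> H" and "K = \<psi> ` H"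
  shows "conj_map \<G> \<G>' \<psi> \<in> iso (stabiliser_group \<G> H) (stabiliser_group \<G>' K)
       \<and> homeomorphic_map
           (subtopology (very_strong_topology (arr \<G>) (arr \<G>)) (stabiliser \<G> H))
           (subtopology (very_strong_topology (arr \<G>') (arr \<G>')) (stabiliser \<G>' K))
           (conj_map \<G> \<G>' \<psi>)
       \<and> homeomorphic_map
           (subtopology (fine_very_strong_topology (arr \<G>) (arr \<G>)) (stabiliser \<G> H))
           (subtopology (fine_very_strong_topology (arr \<G>') (arr \<G>')) (stabiliser \<G>' K))
           (conj_map \<G> \<G>' \<psi>)"
proof -
  interpret lie_groupoid_iso_pair \<G> \<G>' \<psi> "inv_into (arrows \<G>) \<psi>"
    using assms(1,2,4) by (rule lie_groupoid_iso_pair_inv_into)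
  \<comment> \<open>Equality holds on all arguments, both sides being \<open>undefined\<close> off
    the arrows of \<open>\<G>'\<close>.\<close>
  have conj: "conj_map \<G> \<G>' \<psi> = maps.tr"
    by (simp add: fun_eq_iff conj_map_def transport_def restrict_def)
  have H: "H \<subseteq> arrows \<G>" using assms(5) by (rule wide_lie_subgroupoid_subset)
  note top = maps.topspace_very_strong diffeo_pairs.topspace_very_strong[OF maps.sym]
    maps.topspace_fine_very_strong diffeo_pairs.topspace_fine_very_strong[OF maps.sym]
  show ?thesis
    unfolding conj assms(6)
    using tr_iso[OF H] homeomorphic_map_stabiliser[OF H maps.homeomorphic_maps_very_strong top(1,2)]
      homeomorphic_map_stabiliser[OF H maps.homeomorphic_maps_fine_very_strong top(3,4)] by blast
qed

end
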